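(* Let $q$ be an odd prime power and let $\mathcal{P}_C=\{\xi^2 : \xi\in\mathcal{C}_q\}\cup\{0\}\subseteq\mathbb{F}_q[i]$, where $\mathcal{C}_q=\{z\in\mathbb{F}_q[i] : N(z)=1\}$. Then $\mathcal{P}_C$ is an integral point set. If moreover $q\notin\{5,9\}$, then $\mathcal{P}_C$ is a maximal integral point set.
   Context: Let $\mathbb{F}_q$ be the field with $q$ elements, $q$ odd, and $\square_q$ the set of squares in $\mathbb{F}_q$ including $0$. The affine plane $\mathbb{F}_q^2$ is identified with the ring $\mathbb{F}_q[i]=\mathbb{F}_q[X]/(X^2+1)$, where $i$ is the class of $X$, via $(x,y)\leftrightarrow x+yi$; for $x,y\in\mathbb{F}_q$ put $N(x+yi)=x^2+y^2$. Points $z,w$ are at integral distance if $N(z-w)\in\square_q$. A point set is integral if all pairs of its points are at integral distance; an integral point set is maximal if it is not properly contained in another integral point set in $\mathbb{F}_q^2$. *)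

theory Defs
  imports "HOL-Computational_Algebra.Computational_Algebra" "HOL-Library.Cardinality"
begin

text \<open>
  The ring \<open>F[i] = F[X]/(X\<^sup>2 + 1)\<close>, with \<open>Gauss x y\<close> standing both for \<open>x + y i\<close> and for
  the point \<open>(x, y)\<close> of the affine plane. It is a field only if \<open>-1\<close> is not a square in \<open>F\<close>.
  Lemmas \<open>of_poly_*\<close> below verify that this is the quotient ring.
\<close>

datatype 'a gauss = Gauss (gre: 'a) (gim: 'a)

instantiation gauss :: (comm_ring_1) comm_ring_1
begin

definition "0 = Gauss 0 0"
definition "1 = Gauss 1 0"
definition "z + w = Gauss (gre z + gre w) (gim z + gim w)"
definition "- z = Gauss (- gre z) (- gim z)"
definition "z - w = Gauss (gre z - gre w) (gim z - gim w)"
definition "z * w = Gauss (gre z * gre w - gim z * gim w) (gre z * gim w + gim z * gre w)"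

instance
  by standard
    (simp_all add: zero_gauss_def one_gauss_def plus_gauss_def uminus_gauss_def
      minus_gauss_def times_gauss_def algebra_simps)

end

lemmas gauss_arith_defs =
  zero_gauss_def one_gauss_def plus_gauss_def uminus_gauss_def minus_gauss_def times_gauss_def

definition of_poly :: "'a::field poly \<Rightarrow> 'a gauss" where
  "of_poly p = (let r = p mod [:1, 0, 1:] in Gauss (coeff r 0) (coeff r 1))"

lemma mod_X2_1_cases:
  obtains a b where "p mod [:1, 0, 1 :: 'a::field:] = [:a, b:]"
proof -
  have "degree (p mod [:1, 0, 1 :: 'a:]) \<le> 1"
    using degree_mod_less[of "[:1, 0, 1 :: 'a:]" p] by auto
  then have "p mod [:1, 0, 1 :: 'a:] = [:coeff (p mod [:1, 0, 1:]) 0, coeff (p mod [:1, 0, 1:]) 1:]"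
    by (intro poly_eqI) (auto simp: coeff_pCons coeff_eq_0 split: nat.split)
  then show thesis by (rule that)
qed

lemma linear_mod_X2_1 [simp]: "[:a, b:] mod [:1, 0, 1 :: 'a::field:] = [:a, b:]"
  by (rule mod_poly_less) auto

lemma quadratic_mod_X2_1: "[:a, b, c:] mod [:1, 0, 1 :: 'a::field:] = [:a - c, b:]"
proof -
  have "[:a, b, c:] = [:a - c, b:] + [:c:] * [:1, 0, 1:]" by simp
  then show ?thesis by (metis linear_mod_X2_1 mod_mult_self1)
qed

lemma of_poly_linear: "of_poly [:a, b:] = Gauss a b"
  by (simp add: of_poly_def)

lemma of_poly_X: "of_poly [:0, 1:] = Gauss 0 1"
  by (rule of_poly_linear)

lemma of_poly_1: "of_poly 1 = 1"
  using of_poly_linear[of 1 0] by (simp add: one_gauss_def one_pCons)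

lemma of_poly_add: "of_poly (p + q) = of_poly p + of_poly q"
  by (simp add: of_poly_def Let_def poly_mod_add_left plus_gauss_def)

lemma of_poly_mult: "of_poly (p * q) = of_poly p * of_poly q"
proof -
  obtain a b where p: "p mod [:1, 0, 1:] = [:a, b:]" by (rule mod_X2_1_cases)
  obtain c d where q: "q mod [:1, 0, 1:] = [:c, d:]" by (rule mod_X2_1_cases)
  have "p * q mod [:1, 0, 1:] = [:a, b:] * [:c, d:] mod [:1, 0, 1:]"
    by (metis mod_mult_eq p q)
  also have "[:a, b:] * [:c, d:] = [:a * c, a * d + b * c, b * d:]"
    by (simp add: algebra_simps)
  also have "\<dots> mod [:1, 0, 1:] = [:a * c - b * d, a * d + b * c:]"
    by (rule quadratic_mod_X2_1)
  finally show ?thesis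
    by (simp add: of_poly_def Let_def p q times_gauss_def)
qed

lemma of_poly_eq_0_iff: "of_poly p = 0 \<longleftrightarrow> [:1, 0, 1:] dvd p"
proof -
  obtain a b where p: "p mod [:1, 0, 1:] = [:a, b:]" by (rule mod_X2_1_cases)
  show ?thesis
    by (simp add: of_poly_def Let_def p zero_gauss_def dvd_eq_mod_eq_0)
qed

lemma surj_of_poly: "surj of_poly"
  unfolding surj_def by (metis gauss.exhaust of_poly_linear)

definition gnorm :: "'a::comm_ring_1 gauss \<Rightarrow> 'a" where
  "gnorm z = (gre z)\<^sup>2 + (gim z)\<^sup>2"

definition squares :: "'a::comm_ring_1 set" where
  "squares = {x\<^sup>2 | x. True}"

definition integral_distance :: "'a::comm_ring_1 gauss \<Rightarrow> 'a gauss \<Rightarrow> bool" where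
  "integral_distance z w \<longleftrightarrow> gnorm (z - w) \<in> squares"

definition integral_point_set :: "'a::comm_ring_1 gauss set \<Rightarrow> bool" where
  "integral_point_set P \<longleftrightarrow> (\<forall>z\<in>P. \<forall>w\<in>P. integral_distance z w)"

definition maximal_integral_point_set :: "'a::comm_ring_1 gauss set \<Rightarrow> bool" where
  "maximal_integral_point_set P \<longleftrightarrow>
     integral_point_set P \<and> \<not> (\<exists>Q. integral_point_set Q \<and> P \<subset> Q)"

definition unit_circle :: "'a::comm_ring_1 gauss set" where
  "unit_circle = {z. gnorm z = 1}"

definition circle_point_set :: "'a::comm_ring_1 gauss set" where
  "circle_point_set = {\<xi>\<^sup>2 | \<xi>. \<xi> \<in> unit_circle} \<union> {0}"

end

theory Submission
  imports Defs
begin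

text \<open>
  Let \<open>w\<close> be at integral distance from all points of \<open>P\<^sub>C\<close>. If \<open>N w = 1\<close>, the distance
  from \<open>1\<close> already forces \<open>w\<close> to be the square of a point of the circle (half-angle formula).
  Otherwise Euler's criterion turns the hypothesis into an identity between \<open>n\<close>-th powers of
  linear polynomials in \<open>s\<close>, valid for all \<open>n\<close>-th roots of unity \<open>s\<close>; such an identity holds
  coefficientwise in all degrees \<open>k\<close> with \<open>0 < k < n\<close>.

  If \<open>-1\<close> is not a square, \<open>P\<^sub>C - {0}\<close> is the group of \<open>m\<close>-th roots of unity in the field \<open>F[i]\<close>
  with \<open>m = (q + 1) / 2\<close>. A norm \<open>N z\<close> is a square iff \<open>z ^ m\<close> is fixed by conjugation, so
  \<open>(cnj w * s - 1) ^ m = (w - s) ^ m\<close>, and the coefficients of degree 1 and 2 yield \<open>N w = 1\<close>.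

  If \<open>-1\<close> is a square, \<open>F[i]\<close> is \<open>F \<times> F\<close>, the norm is the product of the coordinates \<open>u, v\<close>, and
  \<open>P\<^sub>C - {0}\<close> consists of the points \<open>(s, 1 / s)\<close> with \<open>s\<close> a nonzero square. With \<open>n = (q - 1) / 2\<close>
  one has \<open>(u - s) ^ n = (v s - 1) ^ n\<close> away from the roots, and the coefficients of degree at most 5
  are contradictory, in every characteristic, as soon as \<open>n > 5\<close>.
\<close>

section \<open>Polynomials vanishing on roots of unity\<close>

text \<open>\<open>'a gauss\<close> is only a \<open>comm_ring_1\<close>, so the usual bound on the
  number of roots is redone under the weaker condition that differences of distinct points of
  \<open>S\<close> are not zero divisors. This is exactly what splitting off one root after another
  needs.\<close>

lemma poly_eq_0_of_many_roots:
  fixes p :: "'r::comm_ring_1 poly"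
  assumes "finite S" "degree p < card S" "\<And>x. x \<in> S \<Longrightarrow> poly p x = 0"
    and "\<And>x y z. x \<in> S \<Longrightarrow> y \<in> S \<Longrightarrow> x \<noteq> y \<Longrightarrow> (x - y) * z = 0 \<Longrightarrow> z = 0"
  shows "p = 0"
  using assms
proof (induction "card S" arbitrary: S p)
  case 0
  then show ?case by simp
next
  case (Suc k)
  then obtain a where a: "a \<in> S" by fastforce
  with Suc.prems have "[:- a, 1:] dvd p"
    by (simp flip: poly_eq_0_iff_dvd)
  then obtain r where r: "p = [:- a, 1:] * r" by (elim dvdE)
  have r': "p = pCons 0 r - smult a r" using r by simp
  show ?case
  proof (cases "r = 0")
    case False
    \<comment> \<open>The split-off factor is monic, so the degree grows by one even if there are
      zero divisors.\<close>
    have deg: "degree p = Suc (degree r)"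
    proof (rule antisym)
      show "degree p \<le> Suc (degree r)"
        by (rule degree_le) (auto simp: r' coeff_pCons coeff_eq_0 split: nat.split)
      have "coeff p (Suc (degree r)) = lead_coeff r"
        by (simp add: r' coeff_eq_0)
      with False show "Suc (degree r) \<le> degree p"
        by (intro le_degree) simp
    qed
    have "r = 0"
    proof (rule Suc.hyps(1)[of "S - {a}"])
      show "k = card (S - {a})" using Suc.hyps(2) a Suc.prems(1) by simp
      show "degree r < card (S - {a})" using Suc.hyps(2) a Suc.prems(1,2) deg by simp
      show "poly r x = 0" if "x \<in> S - {a}" for x
      proof (rule Suc.prems(4)[of x a])
        show "(x - a) * poly r x = 0"
          using Suc.prems(3)[of x] that by (simp add: r algebra_simps)
      qed (use that a in auto)
    qed (use Suc.prems in auto)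
    then show ?thesis by (simp add: r)
  qed (simp add: r)
qed

text \<open>Subtracting \<open>coeff p n\<close> times X^n - 1, which vanishes on \<open>S\<close>,
  pushes the degree below \<open>n\<close> and touches only the coefficients 0 and \<open>n\<close>.
  The remainder has too many roots.\<close>

lemma inner_coeff_eq_0_of_roots_of_unity:
  fixes p :: "'r::comm_ring_1 poly"
  assumes "finite S" "n \<le> card S" "\<And>x. x \<in> S \<Longrightarrow> x ^ n = 1"
    and "degree p \<le> n" "\<And>x. x \<in> S \<Longrightarrow> poly p x = 0"
    and "\<And>x y z. x \<in> S \<Longrightarrow> y \<in> S \<Longrightarrow> x \<noteq> y \<Longrightarrow> (x - y) * z = 0 \<Longrightarrow> z = 0"
    and k: "0 < k" "k < n"
  shows "coeff p k = 0"
proof -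
  define r where "r = p - smult (coeff p n) (monom 1 n - 1)"
  have "r = 0"
  proof (rule poly_eq_0_of_many_roots[of S])
    have "degree r < n"
    proof -
      have "coeff r i = 0" if "n - 1 < i" for i
        using that k assms(4) by (auto simp: r_def coeff_eq_0 not_less_iff_gr_or_eq)
      then have "degree r \<le> n - 1" by (intro degree_le) auto
      with k show ?thesis by simp
    qed
    with assms(2) show "degree r < card S" by simp
    show "poly r x = 0" if "x \<in> S" for x
      using assms(3,5)[OF that] by (simp add: r_def poly_monom)
    show "z = 0" if "x \<in> S" "y \<in> S" "x \<noteq> y" "(x - y) * z = 0" for x y z
      using that by (rule assms(6))
  qed (rule assms(1))
  then have "coeff r k = 0" by simp
  with k show ?thesis by (simp add: r_def)
qed

lemma degree_linear_power_le: "degree ([:a, b :: 'r::comm_ring_1:] ^ n) \<le> n"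
proof -
  have "degree ([:a, b:] ^ n) \<le> degree [:a, b:] * n" by (rule degree_power_le)
  also have "\<dots> \<le> 1 * n" by (intro mult_le_mono) auto
  finally show ?thesis by simp
qed

text \<open>Choosing one root for each square, the chosen roots and their negatives cover
  \<open>A\<close>.\<close>

lemma card_le_twice_card_squares:
  fixes A :: "'r::comm_ring_1 set"
  assumes "finite A" "\<And>x y. x \<in> A \<Longrightarrow> y \<in> A \<Longrightarrow> x\<^sup>2 = y\<^sup>2 \<Longrightarrow> x = y \<or> x = - y"
  shows "card A \<le> 2 * card ((\<lambda>x. x\<^sup>2) ` A)"
proof -
  let ?B = "(\<lambda>x. x\<^sup>2) ` A"
  let ?f = "inv_into A (\<lambda>x. x\<^sup>2)"
  have "A \<subseteq> ?f ` ?B \<union> (\<lambda>x. - ?f x) ` ?B"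
  proof
    fix x assume x: "x \<in> A"
    then have "?f (x\<^sup>2) \<in> A" "(?f (x\<^sup>2))\<^sup>2 = x\<^sup>2"
      by (auto intro!: inv_into_into f_inv_into_f[of _ "\<lambda>x. x\<^sup>2"])
    with assms(2)[OF x] have "x = ?f (x\<^sup>2) \<or> x = - ?f (x\<^sup>2)" by simp
    with x show "x \<in> ?f ` ?B \<union> (\<lambda>x. - ?f x) ` ?B" by blast
  qed
  then have "card A \<le> card (?f ` ?B \<union> (\<lambda>x. - ?f x) ` ?B)"
    using assms(1) by (intro card_mono) auto
  also have "\<dots> \<le> card (?f ` ?B) + card ((\<lambda>x. - ?f x) ` ?B)" by (rule card_Un_le)
  also have "\<dots> \<le> card ?B + card ?B" using assms(1) by (intro add_mono card_image_le) auto
  finally show ?thesis by simp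
qed

section \<open>Fermat's theorem and binomial coefficients modulo the characteristic\<close>

lemma power_CARD_minus_1:
  fixes x :: "'a::{field,finite}"
  assumes "x \<noteq> 0"
  shows "x ^ (CARD('a) - 1) = 1"
proof -
  have "x ^ (CARD('a) - 1) * \<Prod>(UNIV - {0}) = (\<Prod>y\<in>UNIV - {0}. x * y)"
    by (simp add: prod.distrib card_Diff_singleton)
  also have "\<dots> = \<Prod>(UNIV - {0})"
    by (rule prod.reindex_bij_witness[of _ "\<lambda>y. y / x" "\<lambda>y. x * y"]) (use assms in auto)
  finally show ?thesis by simp
qed

lemma power_CARD: "x ^ CARD('a) = x" for x :: "'a::{field,finite}"
proof (cases "x = 0")
  case False
  have "x ^ CARD('a) = x * x ^ (CARD('a) - 1)" using power_Suc[of x "CARD('a) - 1"] by simp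
  also have "x ^ (CARD('a) - 1) = 1" using False by (rule power_CARD_minus_1)
  finally show ?thesis by simp
qed simp

text \<open>The polynomial (1 + X)^q - X^q - 1 has degree below q but vanishes at all q elements of
  the field.\<close>

lemma of_nat_CARD_choose_eq_0:
  assumes "0 < k" "k < CARD('a)"
  shows "of_nat (CARD('a) choose k) = (0 :: 'a::{field,finite})"
proof -
  let ?q = "CARD('a)"
  define p :: "'a poly" where "p = [:1, 1:] ^ ?q - monom 1 ?q - 1"
  have "p = 0"
  proof (rule poly_eq_0_of_many_roots[of UNIV])
    have "coeff p i = 0" if "?q - 1 < i" for i
    proof (cases "i = ?q")
      case True
      then show ?thesis by (simp add: p_def coeff_linear_poly_power)
    next
      case False
      with that have "?q < i" by simp
      then have "coeff ([:1, 1 :: 'a:] ^ ?q) i = 0"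
        using degree_linear_power_le[of 1 "1 :: 'a" ?q] by (intro coeff_eq_0) simp
      with \<open>?q < i\<close> show ?thesis by (simp add: p_def)
    qed
    then have "degree p \<le> ?q - 1" by (intro degree_le) auto
    moreover have "?q > 0" by simp
    ultimately show "degree p < card (UNIV :: 'a set)" by linarith
    show "poly p x = 0" for x
      by (simp add: p_def poly_power poly_monom power_CARD)
  qed auto
  then have "coeff p k = 0" by simp
  with assms show ?thesis by (simp add: p_def coeff_linear_poly_power)
qed

section \<open>Squares in a finite field of odd order\<close>

lemma squares_iff: "x \<in> squares \<longleftrightarrow> (\<exists>y. x = y\<^sup>2)"
  by (auto simp: squares_def)

lemma square_in_squares [simp]: "x\<^sup>2 \<in> squares"
  by (auto simp: squares_def)

lemma zero_in_squares [simp]: "0 \<in> squares"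
  by (auto simp: squares_iff intro: exI[of _ 0])

lemma one_in_squares [simp]: "1 \<in> squares"
  by (auto simp: squares_iff intro: exI[of _ 1])

lemma squares_mult: "x \<in> squares \<Longrightarrow> y \<in> squares \<Longrightarrow> x * y \<in> squares"
  unfolding squares_iff by (metis power_mult_distrib)

lemma squares_divide: "x \<in> squares \<Longrightarrow> y \<in> squares \<Longrightarrow> x / y \<in> squares"
  for x y :: "'a::field"
  unfolding squares_iff by (metis power_divide)

lemma squares_cancel:
  fixes x y :: "'a::field"
  assumes "x * y \<in> squares" "y \<in> squares" "y \<noteq> 0"
  shows "x \<in> squares"
  using squares_divide[OF assms(1,2)] assms(3) by simp

lemma eq_if_mult_eq_1_sign:
  fixes x y :: "'a::comm_ring_1"
  assumes "x * y = 1" "y = 1 \<or> y = - 1"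
  shows "x = y"
proof -
  have "y * y = 1" using assms(2) by auto
  then have "x = (x * y) * y" by (simp add: mult.assoc)
  with assms(1) show ?thesis by simp
qed

context
  fixes n :: nat
  assumes card: "CARD('a::{field,finite}) = 2 * n + 1"
begin

lemma odd_card_two_neq_0: "(2 :: 'a) \<noteq> 0"
proof
  assume "(2 :: 'a) = 0"
  moreover have "1 < CARD('a)" using card_mono[of UNIV "{0, 1 :: 'a}"] by simp
  then have "of_nat (2 * n + 1) = (0 :: 'a)"
    using of_nat_CARD_choose_eq_0[of 1, where 'a='a] card by simp
  ultimately show False by simp
qed

lemma odd_card_four_neq_0: "(4 :: 'a) \<noteq> 0"
proof -
  have "(2 * 2 :: 'a) \<noteq> 0" unfolding mult_eq_0_iff using odd_card_two_neq_0 by simp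
  then show ?thesis by simp
qed

lemma odd_card_half_pos: "0 < n"
  using card card_mono[of UNIV "{0, 1 :: 'a}"] by simp

lemma odd_card_two_n: "2 * of_nat n = (- 1 :: 'a)"
proof -
  have "of_nat (2 * n + 1) = (0 :: 'a)"
    using of_nat_CARD_choose_eq_0[of 1, where 'a='a] card odd_card_half_pos by simp
  then show ?thesis by (simp add: eq_neg_iff_add_eq_0 add.commute)
qed

lemma square_power_half:
  assumes "x \<in> squares" "x \<noteq> (0 :: 'a)"
  shows "x ^ n = 1"
proof -
  obtain y where "x = y\<^sup>2" using assms(1) by (auto simp: squares_iff)
  with assms(2) show ?thesis
    using power_CARD_minus_1[of y] card by (simp flip: power_mult)
qed

lemma card_nonzero_squares: "n \<le> card (squares - {0 :: 'a})"
proof -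
  have "card (UNIV - {0 :: 'a}) \<le> 2 * card ((\<lambda>x. x\<^sup>2) ` (UNIV - {0 :: 'a}))"
    by (intro card_le_twice_card_squares) (auto simp: power2_eq_iff)
  also have "(\<lambda>x. x\<^sup>2) ` (UNIV - {0 :: 'a}) = squares - {0}"
    by (force simp: squares_iff)
  finally show ?thesis using card by (simp add: card_Diff_singleton)
qed

text \<open>The nonzero squares already supply \<open>n\<close> roots of X^n - 1, so a nonsquare
  cannot be a further one; its \<open>n\<close>-th power squares to 1 and must be -1.\<close>

lemma nonsquare_power_half:
  assumes "x \<notin> squares"
  shows "x ^ n = (- 1 :: 'a)"
proof -
  have x0: "x \<noteq> 0" using assms by auto
  have "x ^ n \<noteq> 1"
  proof
    assume x: "x ^ n = 1"
    let ?p = "monom 1 n - 1 :: 'a poly"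
    have "?p = 0"
    proof (rule poly_eq_0_of_many_roots[of "insert x (squares - {0})"])
      have "degree ?p \<le> n"
        by (intro degree_diff_le) (auto simp: degree_monom_le)
      moreover have "card (insert x (squares - {0 :: 'a})) \<ge> Suc n"
        using assms card_nonzero_squares by (subst card_insert_disjoint) auto
      ultimately show "degree ?p < card (insert x (squares - {0}))" by simp
    qed (auto simp: poly_monom x square_power_half)
    then have "coeff ?p n = 0" by simp
    then show False using odd_card_half_pos by simp
  qed
  moreover have "x ^ n = 1 \<or> x ^ n = - 1"
    using power_CARD_minus_1[OF x0] card
    by (simp add: power_mult mult.commute[of 2] power2_eq_1_iff)
  ultimately show ?thesis by simp
qed

lemma squares_neq_UNIV: "squares \<noteq> (UNIV :: 'a set)"
proof
  assume "squares = (UNIV :: 'a set)"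
  then have "surj (\<lambda>x :: 'a. x\<^sup>2)" by (auto simp: squares_iff surj_def)
  then have "inj (\<lambda>x :: 'a. x\<^sup>2)" by (simp add: finite_UNIV_surj_inj)
  then have "(1 :: 'a) = - 1" by (rule injD) simp
  then show False using odd_card_two_neq_0 by (simp add: eq_neg_iff_add_eq_0)
qed

text \<open>Excludes points with exactly one zero coordinate in F x F. If \<open>a\<close> is a
  nonsquare, \<open>s = 1\<close> and \<open>s\<close> the inverse of \<open>a\<^sup>2\<close>
  exhibit \<open>a\<close> as a quotient of squares. If \<open>a\<close> is a square, the squares
  are closed under subtraction, and every element is a difference of two squares.\<close>

lemma not_all_one_minus_multiple_square:
  fixes a :: 'a
  assumes neg: "(- 1 :: 'a) \<in> squares" and a: "a \<noteq> 0"
    and sq: "\<And>s. s \<in> squares \<Longrightarrow> s \<noteq> 0 \<Longrightarrow> 1 - a * s \<in> squares"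
  shows False
proof (cases "a \<in> squares")
  case False
  have "1 - a * 1 \<in> squares" by (intro sq) auto
  then have 1: "1 - a \<in> squares" by simp
  have "inverse (a\<^sup>2) \<in> squares"
    using squares_divide[of 1 "a\<^sup>2"] by (simp add: inverse_eq_divide)
  then have "1 - a * inverse (a\<^sup>2) \<in> squares" using a by (intro sq) auto
  with neg have "(- 1) * (1 - a * inverse (a\<^sup>2)) \<in> squares" by (rule squares_mult)
  also have "(- 1) * (1 - a * inverse (a\<^sup>2)) = (1 - a) / a"
    using a by (simp add: field_simps power2_eq_square)
  finally have sq': "(1 - a) / ((1 - a) / a) \<in> squares" by (rule squares_divide[OF 1])
  have "1 - a \<noteq> 0" using False one_in_squares by (metis eq_iff_diff_eq_0)
  then have "(1 - a) / ((1 - a) / a) = a" using a by simp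
  with sq' have "a \<in> squares" by (rule back_subst)
  with False show False ..
next
  case True
  have one: "1 - s \<in> squares" if "s \<in> squares" for s :: 'a
  proof (cases "s = 0")
    case False
    have "1 - a * (s / a) \<in> squares"
      using True that a False by (intro sq squares_divide) auto
    with a show ?thesis by simp
  qed simp
  have diff: "x - y \<in> squares" if "x \<in> squares" "y \<in> squares" for x y :: 'a
  proof (cases "x = 0")
    case True
    then show ?thesis using squares_mult[OF neg that(2)] by simp
  next
    case False
    have "x * (1 - y / x) \<in> squares"
      using that by (intro squares_mult one squares_divide)
    with False show ?thesis by (simp add: algebra_simps)
  qed
  have "x \<in> squares" for x :: 'a
  proof -
    have "((x + 1) / 2)\<^sup>2 - ((x - 1) / 2)\<^sup>2 \<in> squares" by (intro diff) auto
    also have "((x + 1) / 2)\<^sup>2 - ((x - 1) / 2)\<^sup>2 = x * (2 * 2) / (2 * 2)"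
      by (simp add: power2_eq_square field_simps)
    finally show ?thesis using odd_card_four_neq_0 by simp
  qed
  then show False using squares_neq_UNIV by blast
qed

text \<open>Modulo the characteristic, \<open>n\<close> is \<open>-1/2\<close>, so these are the coefficients of
  \<open>(1 + X) powr (-1/2)\<close>; squaring and using \<open>(1 + X) ^ q = 1 + X ^ q\<close> gives them even when the
  characteristic divides \<open>k!\<close>.\<close>
lemma half_choose:
  assumes "5 < CARD('a)"
  defines "b k \<equiv> of_nat (n choose k) :: 'a"
  shows "2 * b 1 = - 1" "8 * b 2 = 3" "16 * b 3 = - 5" "128 * b 4 = 35" "256 * b 5 = - 63"
proof -
  define c where "c k = (of_nat ((2 * n) choose k) :: 'a)" for k
  \<comment> \<open>Pascal's rule, as the inner binomial coefficients of \<open>2 * n + 1\<close>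
    vanish in the field.\<close>
  have c: "c (Suc k) = - c k" if "k < 5" for k
  proof -
    have "of_nat ((2 * n + 1) choose Suc k) = (0 :: 'a)"
      using of_nat_CARD_choose_eq_0[of "Suc k", where 'a='a] that assms(1) card by simp
    then show ?thesis by (simp add: c_def eq_neg_iff_add_eq_0 add.commute)
  qed
  have conv: "c k = (\<Sum>i\<le>k. b i * b (k - i))" for k
    using arg_cong[OF vandermonde[of n n k], of "of_nat :: nat \<Rightarrow> 'a"]
    by (simp add: c_def b_def mult_2)
  have b0: "b 0 = 1" by (simp add: b_def)
  have c0: "c 0 = 1" by (simp add: c_def)
  have cs: "c 1 = - 1" "c 2 = 1" "c 3 = - 1" "c 4 = 1" "c 5 = - 1"
    using c[of 0] c[of 1] c[of 2] c[of 3] c[of 4] c0 by (simp_all add: numeral_eq_Suc)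
  have "c 1 = 2 * b 1" "c 2 = 2 * b 2 + b 1 * b 1" "c 3 = 2 * b 3 + 2 * b 1 * b 2"
    "c 4 = 2 * b 4 + 2 * b 1 * b 3 + b 2 * b 2" "c 5 = 2 * b 5 + 2 * b 1 * b 4 + 2 * b 2 * b 3"
    unfolding conv by (simp_all add: numeral_eq_Suc b0 algebra_simps)
  note e = this[unfolded cs, symmetric]
  show 1: "2 * b 1 = - 1" by (rule e)
  \<comment> \<open>The convolution identities are scaled by powers of 2 so that only multiples of
    earlier \<open>b k\<close> with known value occur and nothing is divided.\<close>
  have "8 * b 2 = 4 * (2 * b 2 + b 1 * b 1) - (2 * b 1) * (2 * b 1)" by (simp add: algebra_simps)
  then show 2: "8 * b 2 = 3" unfolding e(2) unfolding 1 by simp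
  have "16 * b 3 = 8 * (2 * b 3 + 2 * b 1 * b 2) - (2 * b 1) * (8 * b 2)"
    by (simp add: algebra_simps)
  then show 3: "16 * b 3 = - 5" unfolding e(3) unfolding 1 2 by simp
  have "128 * b 4 = 64 * (2 * b 4 + 2 * b 1 * b 3 + b 2 * b 2)
      - 4 * (2 * b 1) * (16 * b 3) - (8 * b 2) * (8 * b 2)"
    by (simp add: algebra_simps)
  then show 4: "128 * b 4 = 35" unfolding e(4) unfolding 1 2 3 by simp
  have "256 * b 5 = 128 * (2 * b 5 + 2 * b 1 * b 4 + 2 * b 2 * b 3)
      - (2 * b 1) * (128 * b 4) - 2 * (8 * b 2) * (16 * b 3)"
    by (simp add: algebra_simps)
  then show 5: "256 * b 5 = - 63" unfolding e(5) unfolding 1 2 3 4 by simp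
qed

end

section \<open>Excluded coordinate pairs in \<open>F \<times> F\<close>\<close>

context
  fixes n :: nat
  assumes card: "CARD('a::{field,finite}) = 2 * n + 1" and n6: "6 \<le> n" and even: "even n"
begin

text \<open>Neither factor vanishes at a nonzero square \<open>s\<close>, so the power identity has
  no exceptions. Degree 1 forces \<open>u * v = - 1\<close>; degrees 2 and 4 then give 3 = 0 and 35
  = 0.\<close>

lemma split_no_nonsquare_point:
  fixes u v :: 'a
  assumes u: "u \<notin> squares" and v: "v \<notin> squares"
    and sq: "\<And>s. s \<in> squares \<Longrightarrow> s \<noteq> 0 \<Longrightarrow> (u - s) * (v * s - 1) \<in> squares"
  shows False
proof -
  let ?b = "\<lambda>k. of_nat (n choose k) :: 'a"
  define p where "p = [:u, - 1:] ^ n - [:- 1, v:] ^ n"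
  have un: "u ^ n = - 1" using nonsquare_power_half[OF card u] .
  have coeff_p: "coeff p k = 0" if "0 < k" "k < n" for k
  proof (rule inner_coeff_eq_0_of_roots_of_unity[of "squares - {0}" n])
    show "poly p s = 0" if s: "s \<in> squares - {0}" for s
    proof -
      have ne: "u - s \<noteq> 0" "v * s - 1 \<noteq> 0"
        using u v s squares_cancel[of v s] by auto
      then have "((u - s) * (v * s - 1)) ^ n = 1"
        using s by (intro square_power_half[OF card] sq) auto
      then have *: "(u - s) ^ n * (v * s - 1) ^ n = 1" by (simp add: power_mult_distrib)
      have "(v * s - 1) ^ n = 1 \<or> (v * s - 1) ^ n = - 1"
        using square_power_half[OF card] nonsquare_power_half[OF card] ne(2) by metis
      with * have "(u - s) ^ n = (v * s - 1) ^ n" by (rule eq_if_mult_eq_1_sign)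
      then show ?thesis by (simp add: p_def poly_power mult.commute)
    qed
    show "degree p \<le> n"
      unfolding p_def by (intro degree_diff_le degree_linear_power_le)
  qed (use that card_nonzero_squares[OF card] square_power_half[OF card] in auto)
  have rel: "?b k * ((u * v) ^ k + 1) = 0" if k: "0 < k" "k < n" for k
  proof -
    \<comment> \<open>The factor \<open>u ^ k\<close> completes \<open>u ^ (n - k)\<close> to
      \<open>u ^ n\<close>, and the sign cancels because \<open>n\<close> is even.\<close>
    have "0 = coeff p k * u ^ k * (- 1) ^ k" using coeff_p[OF k] by simp
    also have "\<dots> = ?b k * (u ^ (n - k) * u ^ k * ((- 1) ^ k * (- 1) ^ k)
        - (u * v) ^ k * ((- 1) ^ (n - k) * (- 1) ^ k))"
      using k by (simp add: p_def coeff_linear_poly_power algebra_simps)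
    also have "u ^ (n - k) * u ^ k = - 1" using k un by (simp flip: power_add)
    also have "(- 1 :: 'a) ^ k * (- 1) ^ k = 1" by (simp flip: power_add)
    also have "(- 1 :: 'a) ^ (n - k) * (- 1) ^ k = 1"
      using k even by (simp flip: power_add)
    finally show ?thesis by (simp add: algebra_simps)
  qed
  have q5: "5 < CARD('a)" using card n6 by simp
  note b = half_choose[OF card q5]
  have two: "(2 :: 'a) \<noteq> 0" using odd_card_two_neq_0[OF card] .
  have "?b 1 \<noteq> 0" using b(1) by auto
  then have uv: "u * v = - 1" using rel[of 1] n6 by (simp add: eq_neg_iff_add_eq_0)
  have "?b 2 * 2 = 0" using rel[of 2] n6 uv by simp
  then have "?b 2 = 0" using two by simp
  then have 3: "(3 :: 'a) = 0" using b(2) by simp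
  have "?b 4 * 2 = 0" using rel[of 4] n6 uv by simp
  then have "?b 4 = 0" using two by simp
  then have "(35 :: 'a) = 0" using b(4) by simp
  then have "(12 * 3 - 1 :: 'a) = 0" by simp
  then show False unfolding 3 by simp
qed

text \<open>Here the relation \<open>(u - s) ^ n = (v s - 1) ^ n\<close> fails at the two roots \<open>s = u, 1 / v\<close>;
  the difference of two Lagrange basis polynomials corrects this.\<close>
lemma split_no_square_point:
  fixes u v :: 'a
  assumes u: "u \<in> squares" "u \<noteq> 0" and v: "v \<in> squares" "v \<noteq> 0" and uv: "u * v \<noteq> 1"
    and sq: "\<And>s. s \<in> squares \<Longrightarrow> s \<noteq> 0 \<Longrightarrow> (u - s) * (v * s - 1) \<in> squares"
  shows False
proof -
  let ?b = "\<lambda>k. of_nat (n choose k) :: 'a"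
  \<comment> \<open>At each exceptional root one of the two powers is 0 and the other is
    \<open>e\<close>.\<close>
  define e where "e = (u * v - 1) ^ n"
  \<comment> \<open>An unnormalized Lagrange basis polynomial: on the \<open>n\<close>-th roots of
    unity it is \<open>n\<close> at 1 / w and 0 elsewhere. Since \<open>n\<close> is -1/2 in the
    field, the factor \<open>2 * e\<close> in \<open>p\<close> gives the right correction.\<close>
  define L where "L w = (\<Sum>j<n. monom (w ^ j) j)" for w :: 'a
  define p where "p = [:u, - 1:] ^ n - [:- 1, v:] ^ n - smult (2 * e) (L (inverse u) - L v)"
  have n2: "of_nat n * (- 2) = (1 :: 'a)"
    using odd_card_two_n[OF card] by (simp add: algebra_simps)
  have un: "u ^ n = 1" and vn: "v ^ n = 1"
    using square_power_half[OF card] u v by auto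
  have poly_L: "poly (L w) s = (if w * s = 1 then of_nat n else 0)"
    if "w ^ n = 1" "s ^ n = 1" for w s
  proof -
    have "poly (L w) s = (\<Sum>j<n. (w * s) ^ j)"
      by (simp add: L_def poly_sum poly_monom power_mult_distrib)
    also have "\<dots> = (if w * s = 1 then of_nat n else ((w * s) ^ n - 1) / (w * s - 1))"
      by (simp add: geometric_sum)
    finally show ?thesis using that by (simp add: power_mult_distrib)
  qed
  have coeff_L: "coeff (L w) k = w ^ k" if "k < n" for w k
    using that by (simp add: L_def coeff_sum)
  have coeff_p: "coeff p k = 0" if "0 < k" "k < n" for k
  proof (rule inner_coeff_eq_0_of_roots_of_unity[of "squares - {0}" n])
    show "poly p s = 0" if s: "s \<in> squares - {0}" for s
    proof -
      have sn: "s ^ n = 1" using s square_power_half[OF card] by auto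
      have Lu: "poly (L (inverse u)) s = (if s = u then of_nat n else 0)"
        using poly_L[of "inverse u" s] un sn u(2) by (simp add: power_inverse field_simps)
      have Lv: "poly (L v) s = (if v * s = 1 then of_nat n else 0)"
        by (rule poly_L[OF vn sn])
      have ps: "poly p s = (u - s) ^ n - (v * s - 1) ^ n
          - 2 * e * (poly (L (inverse u)) s - poly (L v) s)"
        by (simp add: p_def poly_power mult.commute)
      consider "s = u" | "v * s = 1" | "s \<noteq> u" "v * s \<noteq> 1" by blast
      then show ?thesis
      proof cases
        case 1
        then have "poly p s = - e - 2 * e * of_nat n"
          unfolding ps Lu Lv using uv n6 by (simp add: e_def mult.commute)
        also have "\<dots> = e * (of_nat n * (- 2) - 1)" by (simp add: algebra_simps)
        finally show ?thesis unfolding n2 by simp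
      next
        case 2
        have "(u - s) ^ n = (v * s * u - s) ^ n" using 2 by simp
        also have "v * s * u - s = s * (u * v - 1)" by (simp add: algebra_simps)
        also have "\<dots> ^ n = e" by (simp add: power_mult_distrib sn e_def)
        finally have us: "(u - s) ^ n = e" .
        have "s \<noteq> u" using 2 uv by (auto simp: mult.commute)
        then have "poly p s = e + 2 * e * of_nat n"
          using 2 n6 by (simp add: ps Lu Lv us)
        also have "\<dots> = e * (1 - of_nat n * (- 2))" by (simp add: algebra_simps)
        finally show ?thesis unfolding n2 by simp
      next
        case 3
        then have "((u - s) * (v * s - 1)) ^ n = 1"
          using s by (intro square_power_half[OF card] sq) auto
        then have *: "(u - s) ^ n * (v * s - 1) ^ n = 1" by (simp add: power_mult_distrib)
        have "(v * s - 1) ^ n = 1 \<or> (v * s - 1) ^ n = - 1"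
          using square_power_half[OF card] nonsquare_power_half[OF card] 3
          by (metis eq_iff_diff_eq_0)
        with * have "(u - s) ^ n = (v * s - 1) ^ n" by (rule eq_if_mult_eq_1_sign)
        then show ?thesis using 3 by (simp add: ps Lu Lv)
      qed
    qed
    have "degree (L w) \<le> n" for w
      unfolding L_def by (intro degree_sum_le) (auto intro: order_trans[OF degree_monom_le])
    then show "degree p \<le> n"
      unfolding p_def
      by (intro degree_diff_le degree_linear_power_le order_trans[OF degree_smult_le])
  qed (use that card_nonzero_squares[OF card] square_power_half[OF card] in auto)
  have rel: "(u * v) ^ k = 1 \<or> ?b k * (- 1) ^ k = 2 * e" if k: "0 < k" "k < n" for k
  proof -
    have "0 = coeff p k * u ^ k" using coeff_p[OF k] by simp
    \<comment> \<open>Both the binomial part and the correction become multiples of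
      \<open>1 - (u * v) ^ k\<close>, whence the alternative in \<open>rel\<close>.\<close>
    also have "\<dots> = ?b k * ((- 1) ^ k * (u ^ (n - k) * u ^ k) - (u * v) ^ k * (- 1) ^ (n - k))
        - 2 * e * ((inverse u * u) ^ k - (u * v) ^ k)"
      using k by (simp add: p_def coeff_linear_poly_power coeff_L algebra_simps power_mult_distrib)
    also have "u ^ (n - k) * u ^ k = 1" using k un by (simp flip: power_add)
    also have "(- 1 :: 'a) ^ (n - k) = (- 1) ^ k"
      using k even by (simp add: minus_one_power_iff)
    also have "inverse u * u = 1" using u by simp
    finally have "(?b k * (- 1) ^ k - 2 * e) * (1 - (u * v) ^ k) = 0"
      by (simp add: algebra_simps)
    then show ?thesis by auto
  qed
  have q5: "5 < CARD('a)" using card n6 by simp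
  note b = half_choose[OF card q5]
  have two: "(2 :: 'a) \<noteq> 0" using odd_card_two_neq_0[OF card] .
  have e1: "4 * e = 1"
  proof -
    have "4 * e = 2 * (2 * e)" by simp
    also have "2 * e = - ?b 1" using rel[of 1] n6 uv by simp
    finally have "4 * e = - (2 * ?b 1)" by simp
    then show ?thesis unfolding b by simp
  qed
  have "(u * v)\<^sup>2 = 1"
  proof (rule ccontr)
    assume "(u * v)\<^sup>2 \<noteq> 1"
    then have "?b 2 = 2 * e" using rel[of 2] n6 by simp
    then have "8 * ?b 2 = 4 * (4 * e)" by simp
    then have "(3 :: 'a) = 4" unfolding b e1 by simp
    then have "(4 :: 'a) - 3 = 0" by (simp only: right_minus_eq)
    then show False by simp
  qed
  then have uv': "u * v = - 1" using uv by (simp add: power2_eq_1_iff)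
  \<comment> \<open>With \<open>u * v = - 1\<close>, the first alternative of \<open>rel\<close>
    fails in odd degrees. Degrees 3 and 5 give 3 = 0 and 65 = 0, which clash since 65 = 22 * 3 -
    1.\<close>
  have m1: "(- 1 :: 'a) \<noteq> 1" using two by (metis add.right_inverse one_add_one)
  have "- ?b 3 = 2 * e" using rel[of 3] n6 m1 by (simp add: uv')
  then have "?b 3 = - (2 * e)" by (metis minus_minus)
  then have "- (16 * ?b 3) = 8 * (4 * e)" by simp
  then have "(5 :: 'a) = 8" unfolding b e1 by simp
  then have "(8 :: 'a) - 5 = 0" by (simp only: right_minus_eq)
  then have 3: "(3 :: 'a) = 0" by simp
  have "- ?b 5 = 2 * e" using rel[of 5] n6 m1 by (simp add: uv')
  then have "?b 5 = - (2 * e)" by (metis minus_minus)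
  then have "- (256 * ?b 5) = 128 * (4 * e)" by simp
  then have "(63 :: 'a) = 128" unfolding b e1 by simp
  then have "(128 :: 'a) - 63 = 0" by (simp only: right_minus_eq)
  then have "(22 * 3 - 1 :: 'a) = 0" by simp
  then show False unfolding 3 by simp
qed

end

section \<open>Conjugation and norm\<close>

definition gconj :: "'a::comm_ring_1 gauss \<Rightarrow> 'a gauss" where
  "gconj z = Gauss (gre z) (- gim z)"

lemma gconj_mult: "gconj (z * w) = gconj z * gconj w"
  by (simp add: gconj_def times_gauss_def algebra_simps)

lemma gconj_diff: "gconj (z - w) = gconj z - gconj w"
  by (simp add: gconj_def minus_gauss_def)

lemma gconj_1 [simp]: "gconj 1 = 1"
  by (simp add: gconj_def one_gauss_def)

lemma gconj_power: "gconj (z ^ k) = gconj z ^ k"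
  by (induction k) (simp_all add: gconj_mult)

lemma mult_gconj: "z * gconj z = Gauss (gnorm z) 0"
  by (simp add: gconj_def times_gauss_def gnorm_def power2_eq_square)

lemma mult_gconj_unit_circle: "\<xi> \<in> unit_circle \<Longrightarrow> \<xi> * gconj \<xi> = 1"
  by (simp add: mult_gconj unit_circle_def one_gauss_def)

lemma gnorm_mult: "gnorm (z * w) = gnorm z * gnorm w"
  by (simp add: gnorm_def times_gauss_def power2_eq_square algebra_simps)

lemma gnorm_1 [simp]: "gnorm 1 = 1"
  by (simp add: gnorm_def one_gauss_def)

lemma gnorm_0 [simp]: "gnorm 0 = 0"
  by (simp add: gnorm_def zero_gauss_def)

lemma gnorm_power: "gnorm (z ^ k) = gnorm z ^ k"
  by (induction k) (simp_all add: gnorm_mult)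

lemma gnorm_minus: "gnorm (- z) = gnorm z"
  by (simp add: gnorm_def uminus_gauss_def)

lemma unit_circle_power: "\<xi> \<in> unit_circle \<Longrightarrow> \<xi> ^ k \<in> unit_circle"
  by (simp add: unit_circle_def gnorm_power)

lemma gauss_power2: "z\<^sup>2 = Gauss ((gre z)\<^sup>2 - (gim z)\<^sup>2) (2 * (gre z * gim z))"
  by (cases z) (simp add: power2_eq_square times_gauss_def)

text \<open>The left side is N(z - w) N(z + w) = (N z + N w)^2 - (2 Re(z \<open>gconj w\<close>))^2,
  and Re^2 + Im^2 of z \<open>gconj w\<close> is N z N w. For equal norms a single square
  remains.\<close>

lemma gnorm_square_diff:
  "gnorm (z\<^sup>2 - w\<^sup>2) = (gnorm z - gnorm w)\<^sup>2 + (2 * gim (z * gconj w))\<^sup>2"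
  by (cases z; cases w)
    (simp add: gauss_power2 gnorm_def gconj_def times_gauss_def minus_gauss_def
      power2_eq_square algebra_simps)

lemma integral_circle_point_set: "integral_point_set circle_point_set"
proof -
  have "gnorm (\<xi>\<^sup>2 - \<eta>\<^sup>2) \<in> squares" if "\<xi> \<in> unit_circle" "\<eta> \<in> unit_circle" for \<xi> \<eta> :: "'a gauss"
  proof -
    have "gnorm (\<xi>\<^sup>2 - \<eta>\<^sup>2) = (2 * gim (\<xi> * gconj \<eta>))\<^sup>2"
      unfolding gnorm_square_diff using that by (simp add: unit_circle_def)
    then show ?thesis by (simp only: square_in_squares)
  qed
  moreover have "gnorm (\<xi>\<^sup>2) = 1" if "\<xi> \<in> unit_circle" for \<xi> :: "'a gauss"
    using that unit_circle_power[of \<xi> 2] by (simp add: unit_circle_def)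
  ultimately show ?thesis
    by (auto simp: integral_point_set_def integral_distance_def circle_point_set_def gnorm_minus)
qed

section \<open>Points of norm 1\<close>

text \<open>Half-angle formula: \<open>(1 - Re w) / 2\<close> is the square of the imaginary part of a square root
  of \<open>w\<close>.\<close>
lemma square_in_unit_circle_of_integral_distance_1:
  fixes w :: "'a::field gauss"
  assumes two: "(2 :: 'a) \<noteq> 0" and w: "gnorm w = 1" and d: "gnorm (w - 1) \<in> squares"
  shows "\<exists>\<xi>\<in>unit_circle. w = \<xi>\<^sup>2"
proof -
  obtain a b where ab: "w = Gauss a b" by (cases w)
  have 1: "a\<^sup>2 + b\<^sup>2 = 1" using w by (simp add: ab gnorm_def)
  have "gnorm (w - 1) = 2 - 2 * a"
    using 1 by (simp add: ab gnorm_def minus_gauss_def one_gauss_def) algebra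
  with d obtain c where c: "2 - 2 * a = c\<^sup>2" by (auto simp: squares_iff)
  show ?thesis
  proof (cases "c = 0")
    case True
    then have "2 * (1 - a) = 0" using c by (simp add: algebra_simps)
    with two have "a = 1" by simp
    with 1 have "w = 1" by (simp add: ab one_gauss_def)
    then show ?thesis by (intro bexI[of _ 1]) (auto simp: unit_circle_def)
  next
    case False
    \<comment> \<open>Sine and cosine of the half angle: \<open>c\<close> is the chord from 1 to
      \<open>w\<close>, and \<open>b = 2 * f * e\<close> is the double-angle formula.\<close>
    define f e where "f = c / 2" and "e = b / c"
    have cf: "c = 2 * f" using two by (simp add: f_def)
    have f0: "f \<noteq> 0" using False by (simp add: cf)
    have b: "b = 2 * f * e" using False by (simp add: e_def flip: cf)
    have "2 * a = 2 * (1 - 2 * f\<^sup>2)" using c by (simp add: cf algebra_simps power2_eq_square)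
    with two have a: "a = 1 - 2 * f\<^sup>2" by (simp only: mult_cancel_left simp_thms)
    have "(2 * f)\<^sup>2 * (e\<^sup>2 + f\<^sup>2 - 1) = 0" using 1 unfolding a b by algebra
    then have ef: "e\<^sup>2 + f\<^sup>2 = 1" unfolding mult_eq_0_iff power_eq_0_iff using f0 two by simp
    have "w = (Gauss e f)\<^sup>2"
      using ef by (simp add: ab gauss_power2 a b algebra_simps)
    moreover have "Gauss e f \<in> unit_circle" using ef by (simp add: unit_circle_def gnorm_def)
    ultimately show ?thesis by blast
  qed
qed

lemma in_circle_point_set_of_gnorm_1:
  fixes w :: "'a::field gauss"
  assumes "(2 :: 'a) \<noteq> 0" "gnorm w = 1" "\<And>z. z \<in> circle_point_set \<Longrightarrow> integral_distance w z"
  shows "w \<in> circle_point_set"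
proof -
  have "1 \<in> unit_circle" by (simp add: unit_circle_def)
  then have "(1 :: 'a gauss) \<in> circle_point_set"
    unfolding circle_point_set_def using power_one by (metis (mono_tags, lifting) UnI1 mem_Collect_eq)
  then have "gnorm (w - 1) \<in> squares" using assms(3) by (simp add: integral_distance_def)
  from square_in_unit_circle_of_integral_distance_1[OF assms(1,2) this] show ?thesis
    by (auto simp: circle_point_set_def)
qed

section \<open>The case where \<open>-1\<close> is a square\<close>

text \<open>In the coordinates \<open>u\<close>, \<open>v\<close>, the pair (0, 0) is the origin,
  which lies in the set. Pairs with one zero are excluded separately. Otherwise the distance to 0
  makes \<open>u * v\<close> a square, so \<open>u\<close> and \<open>v\<close> are both squares or
  both nonsquares.\<close>

lemma split_gnorm_eq_1:
  fixes w :: "'a::{field,finite} gauss"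
  assumes card: "CARD('a) = 2 * n + 1" and n6: "6 \<le> n" and even: "even n"
    and i0: "i0\<^sup>2 = (- 1 :: 'a)" and w: "w \<notin> circle_point_set"
    and dist: "\<And>z. z \<in> circle_point_set \<Longrightarrow> integral_distance w z"
  shows "gnorm w = 1"
proof (rule ccontr)
  assume norm: "gnorm w \<noteq> 1"
  have two: "(2 :: 'a) \<noteq> 0" using odd_card_two_neq_0[OF card] .
  have four: "(4 :: 'a) \<noteq> 0" using odd_card_four_neq_0[OF card] .
  have i0n: "i0 \<noteq> 0" using i0 by auto
  define u v where "u = gre w + i0 * gim w" and "v = gre w - i0 * gim w"
  have gnorm_split: "gnorm z = (gre z + i0 * gim z) * (gre z - i0 * gim z)" for z
  proof -
    have "(gre z + i0 * gim z) * (gre z - i0 * gim z) = (gre z)\<^sup>2 - i0\<^sup>2 * (gim z)\<^sup>2"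
      by (simp add: algebra_simps power2_eq_square)
    then show ?thesis by (simp add: i0 gnorm_def)
  qed
  have uv: "gnorm w = u * v" by (simp add: gnorm_split u_def v_def)
  have neg: "(- 1 :: 'a) \<in> squares" using i0 by (metis square_in_squares)
  have sq: "(u - s) * (v * s - 1) \<in> squares" if s: "s \<in> squares" "s \<noteq> 0" for s
  proof -
    obtain t where t: "s = t\<^sup>2" using s by (auto simp: squares_iff)
    have t0: "t \<noteq> 0" using s t by auto
    \<comment> \<open>The point with split coordinates (t, 1 / t); its square has the coordinates
      (s, 1 / s).\<close>
    define x y where "x = (t + inverse t) / 2" and "y = (t - inverse t) / (2 * i0)"
    have xy: "x + i0 * y = t" "x - i0 * y = inverse t"
      using two four i0n t0 by (simp_all add: x_def y_def field_simps)
    then have "gnorm (Gauss x y) = 1" using t0 by (simp add: gnorm_split)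
    then have "(Gauss x y)\<^sup>2 \<in> circle_point_set"
      by (auto simp: circle_point_set_def unit_circle_def)
    then have *: "gnorm (w - (Gauss x y)\<^sup>2) \<in> squares"
      using dist by (auto simp: integral_distance_def)
    have "gre ((Gauss x y)\<^sup>2) + i0 * gim ((Gauss x y)\<^sup>2) = (x + i0 * y)\<^sup>2"
      using i0 by (simp add: gauss_power2) algebra
    moreover have "gre ((Gauss x y)\<^sup>2) - i0 * gim ((Gauss x y)\<^sup>2) = (x - i0 * y)\<^sup>2"
      using i0 by (simp add: gauss_power2) algebra
    moreover have "gre (w - z) + i0 * gim (w - z) = u - (gre z + i0 * gim z)"
      "gre (w - z) - i0 * gim (w - z) = v - (gre z - i0 * gim z)" for z
      by (simp_all add: u_def v_def minus_gauss_def algebra_simps)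
    ultimately have "gnorm (w - (Gauss x y)\<^sup>2) = (u - s) * (v - inverse s)"
      unfolding gnorm_split by (simp add: xy t power_inverse)
    with * s have "(u - s) * (v - inverse s) * s \<in> squares" by (auto intro: squares_mult)
    also have "(u - s) * (v - inverse s) * s = (u - s) * (v * s - 1)"
      using s by (simp add: algebra_simps)
    finally show ?thesis .
  qed
  have "u \<noteq> 0 \<or> v \<noteq> 0"
  proof (rule ccontr)
    assume "\<not> (u \<noteq> 0 \<or> v \<noteq> 0)"
    then have "u + v = 0" "u - v = 0" by auto
    then have "2 * gre w = 0" "2 * i0 * gim w = 0" by (simp_all add: u_def v_def algebra_simps)
    with two i0n have "w = 0" by (cases w) (simp add: zero_gauss_def)
    with w show False by (simp add: circle_point_set_def)
  qed
  moreover have "u \<noteq> 0"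
  proof
    assume u: "u = 0"
    with \<open>u \<noteq> 0 \<or> v \<noteq> 0\<close> have v: "v \<noteq> 0" by simp
    have "1 - v * s \<in> squares" if s: "s \<in> squares" "s \<noteq> 0" for s
    proof (rule squares_cancel)
      show "(1 - v * s) * s \<in> squares" using sq[OF s] u by (simp add: algebra_simps)
    qed (use s in auto)
    with neg v show False by (rule not_all_one_minus_multiple_square[OF card])
  qed
  moreover have "v \<noteq> 0"
  proof
    assume v: "v = 0"
    have "1 - u * s \<in> squares" if s: "s \<in> squares" "s \<noteq> 0" for s
    proof -
      \<comment> \<open>For \<open>v = 0\<close> the hypothesis is used at 1 / s, so that clearing
        the denominator leaves \<open>1 - u * s\<close>.\<close>
      have "1 / s \<in> squares" using s by (intro squares_divide) auto
      then have "(u - 1 / s) * (v * (1 / s) - 1) \<in> squares" using s by (intro sq) auto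
      then have "(u - 1 / s) * (v * (1 / s) - 1) * s \<in> squares"
        by (rule squares_mult[OF _ s(1)])
      then show ?thesis using s v by (simp add: algebra_simps)
    qed
    with neg \<open>u \<noteq> 0\<close> show False by (rule not_all_one_minus_multiple_square[OF card])
  qed
  moreover have "gnorm w \<in> squares"
    using dist[of 0] by (simp add: circle_point_set_def integral_distance_def)
  ultimately have "u \<in> squares \<and> v \<in> squares \<or> u \<notin> squares \<and> v \<notin> squares"
    using squares_cancel[of u v] squares_cancel[of v u] by (auto simp: uv mult.commute)
  then show False
    using split_no_nonsquare_point[OF card n6 even _ _ sq]
      split_no_square_point[OF card n6 even _ \<open>u \<noteq> 0\<close> _ \<open>v \<noteq> 0\<close> _ sq] norm uv
    by auto
qed

section \<open>The case where \<open>-1\<close> is not a square\<close>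

lemma of_nat_gauss: "of_nat j = Gauss (of_nat j) 0"
  by (induction j) (simp_all add: zero_gauss_def one_gauss_def plus_gauss_def)

text \<open>The q-th power is additive and fixes the elements of F, while i^q = i^3 = -i because q
  is 3 modulo 4.\<close>

lemma power_CARD_gauss:
  fixes z :: "'a::{field,finite} gauss"
  assumes card: "CARD('a) = 4 * k + 3"
  shows "z ^ CARD('a) = gconj z"
proof -
  let ?q = "CARD('a)"
  define x y I where "x = Gauss (gre z) 0" and "y = Gauss (gim z) 0" and "I = Gauss 0 (1 :: 'a)"
  have z: "z = x + y * I"
    by (cases z) (simp add: x_def y_def I_def plus_gauss_def times_gauss_def)
  have Gauss_power: "Gauss a 0 ^ j = Gauss (a ^ j :: 'a) 0" for a j
    by (induction j) (simp_all add: one_gauss_def times_gauss_def)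
  have xq: "x ^ ?q = x" "y ^ ?q = y"
    unfolding x_def y_def Gauss_power power_CARD by simp_all
  have "I ^ 2 = - 1"
    by (simp add: I_def power2_eq_square times_gauss_def one_gauss_def uminus_gauss_def)
  then have "I ^ 4 = 1" using power_mult[of I 2 2] by simp
  then have "I ^ (4 * k) = 1" by (simp add: power_mult)
  moreover have "I ^ 3 = - I"
    using \<open>I ^ 2 = - 1\<close>
    by (simp add: numeral_3_eq_3 power2_eq_square mult.assoc)
  ultimately have Iq: "I ^ ?q = - I" by (simp add: card power_add)
  have "z ^ ?q = (\<Sum>j\<le>?q. of_nat (?q choose j) * x ^ j * (y * I) ^ (?q - j))"
    unfolding z by (rule binomial_ring)
  also have "\<dots> = (\<Sum>j\<in>{0, ?q}. of_nat (?q choose j) * x ^ j * (y * I) ^ (?q - j))"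
  proof (rule sum.mono_neutral_right)
    show "\<forall>j\<in>{..?q} - {0, ?q}. of_nat (?q choose j) * x ^ j * (y * I) ^ (?q - j) = 0"
    proof
      fix j assume "j \<in> {..?q} - {0, ?q}"
      then have "of_nat (?q choose j) = (0 :: 'a)" by (intro of_nat_CARD_choose_eq_0) auto
      then have "of_nat (?q choose j) = (0 :: 'a gauss)"
        unfolding of_nat_gauss by (simp add: zero_gauss_def)
      then show "of_nat (?q choose j) * x ^ j * (y * I) ^ (?q - j) = 0" by simp
    qed
  qed auto
  also have "\<dots> = x + y * (- I)"
    by (simp add: power_mult_distrib xq Iq)
  also have "\<dots> = gconj z"
    by (simp add: gconj_def x_def y_def I_def plus_gauss_def times_gauss_def uminus_gauss_def)
  finally show ?thesis .
qed

context
  fixes k :: nat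
  assumes card: "CARD('a::{field,finite}) = 4 * k + 3" and neg: "(- 1 :: 'a) \<notin> squares"
begin

text \<open>A nonzero solution would make -1 the square of a quotient of its coordinates. As the
  norm is multiplicative, zero divisors are thereby excluded.\<close>

lemma gnorm_eq_0_inert: "gnorm z = 0 \<Longrightarrow> z = (0 :: 'a gauss)"
proof (rule ccontr)
  assume 0: "gnorm z = 0" and z: "z \<noteq> 0"
  have "gim z \<noteq> 0" using 0 z by (cases z) (auto simp: gnorm_def zero_gauss_def)
  moreover have "(gre z)\<^sup>2 = - 1 * (gim z)\<^sup>2" using 0 by (simp add: gnorm_def eq_neg_iff_add_eq_0)
  ultimately have "(gre z / gim z)\<^sup>2 = - 1" by (simp add: power_divide)
  with neg show False by (metis square_in_squares)
qed

lemma mult_eq_0_inert: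
  fixes z w :: "'a gauss"
  assumes "z * w = 0" shows "z = 0 \<or> w = 0"
proof -
  have "gnorm z * gnorm w = 0" using assms gnorm_mult[of z w] by simp
  then show ?thesis using gnorm_eq_0_inert by auto
qed

text \<open>The count comes from the rational parametrization of the circle from the point \<open>-1\<close>.\<close>
lemma card_unit_circle_squares:
  obtains S :: "'a gauss set" where "finite S" "2 * k + 2 \<le> card S"
    "S \<subseteq> (\<lambda>\<xi>. \<xi>\<^sup>2) ` unit_circle"
proof
  have two: "(2 :: 'a) \<noteq> 0" by (rule odd_card_two_neq_0[of "2 * k + 1"]) (simp add: card)
  define \<phi> where "\<phi> t = Gauss ((1 - t\<^sup>2) / (1 + t\<^sup>2)) (2 * t / (1 + t\<^sup>2))" for t :: 'a
  have den: "1 + t\<^sup>2 \<noteq> 0" for t :: 'a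
  proof
    assume "1 + t\<^sup>2 = 0"
    then have "t\<^sup>2 = - 1" by (simp add: eq_neg_iff_add_eq_0 add.commute)
    with neg show False by (metis square_in_squares)
  qed
  have re: "gre (\<phi> t) + 1 = 2 / (1 + t\<^sup>2)" for t
    using den[of t] by (simp add: \<phi>_def field_simps)
  \<comment> \<open>\<open>t\<close> is the slope of the line through -1, so it is recovered from
    the point and \<open>\<phi>\<close> is injective.\<close>
  have im: "gim (\<phi> t) = t * (gre (\<phi> t) + 1)" for t
    unfolding re by (simp add: \<phi>_def)
  have re0: "gre (\<phi> t) + 1 \<noteq> 0" for t
    unfolding re using den[of t] two by simp
  have "inj \<phi>"
  proof (rule injI)
    fix s t assume "\<phi> s = \<phi> t"
    then have "s * (gre (\<phi> t) + 1) = t * (gre (\<phi> t) + 1)" using im[of s] im[of t] by metis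
    then show "s = t" unfolding mult_cancel_right using re0[of t] by simp
  qed
  moreover have "- 1 \<notin> range \<phi>"
  proof
    assume "- 1 \<in> range \<phi>"
    then obtain t where "- 1 = \<phi> t" by (rule rangeE)
    then have "gre (\<phi> t) + 1 = gre (- 1 :: 'a gauss) + 1" by simp
    also have "\<dots> = 0" by (simp add: uminus_gauss_def one_gauss_def)
    finally show False using re0[of t] by simp
  qed
  \<comment> \<open>The q slopes together with the centre -1 give q + 1 points; squaring at most
    halves their number.\<close>
  ultimately have "card (insert (- 1) (range \<phi>)) = 4 * k + 4"
    by (simp add: card_image card)
  moreover have "x = y \<or> x = - y" if "x\<^sup>2 = y\<^sup>2" for x y :: "'a gauss"
  proof -
    have "(x - y) * (x + y) = 0" using that by (simp add: algebra_simps power2_eq_square)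
    then have "x - y = 0 \<or> x + y = 0" by (rule mult_eq_0_inert)
    then show ?thesis by (simp add: eq_neg_iff_add_eq_0)
  qed
  ultimately show "2 * k + 2 \<le> card ((\<lambda>x. x\<^sup>2) ` insert (- 1) (range \<phi>))"
    using card_le_twice_card_squares[of "insert (- 1) (range \<phi>)"] by auto
  have "gnorm (\<phi> t) = 1" for t
  proof -
    have "(1 - t\<^sup>2)\<^sup>2 + (2 * t)\<^sup>2 = (1 + t\<^sup>2)\<^sup>2" by algebra
    then show ?thesis using den[of t]
      by (simp add: \<phi>_def gnorm_def power_divide flip: add_divide_distrib)
  qed
  then show "(\<lambda>x. x\<^sup>2) ` insert (- 1) (range \<phi>) \<subseteq> (\<lambda>\<xi>. \<xi>\<^sup>2) ` unit_circle"
    by (intro image_mono) (auto simp: unit_circle_def gnorm_minus)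
qed simp

text \<open>Degrees 1 and 2 give \<open>w ^ (m - 1) = gconj w\<close> and
  \<open>w ^ (m - 2) = (gconj w)\<^sup>2\<close>; multiplying the latter by \<open>w\<close> and
  comparing yields (N w - 1) \<open>gconj w\<close> = 0. Degree 2 is an inner degree only for
  \<open>2 < m\<close>, hence the condition on \<open>k\<close>.\<close>

lemma inert_gnorm_eq_1:
  fixes w :: "'a gauss"
  assumes k: "0 < k" and w: "w \<noteq> 0"
    and sq: "\<And>\<xi>. \<xi> \<in> unit_circle \<Longrightarrow> gnorm (w - \<xi>\<^sup>2) \<in> squares"
  shows "gnorm w = 1"
proof -
  define m where "m = 2 * k + 2"
  let ?b = "\<lambda>j. of_nat (m choose j) :: 'a gauss"
  obtain S :: "'a gauss set" where S: "finite S" "m \<le> card S" "S \<subseteq> (\<lambda>\<xi>. \<xi>\<^sup>2) ` unit_circle"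
    using card_unit_circle_squares unfolding m_def by blast
  have q: "CARD('a) + 1 = 2 * m" by (simp add: card m_def)
  have power_2m: "z ^ (2 * m) = Gauss (gnorm z) 0" for z :: "'a gauss"
    unfolding q[symmetric] by (simp add: power_CARD_gauss[OF card] mult.commute flip: mult_gconj)
  have Sm: "s ^ m = 1" if "s \<in> S" for s
  proof -
    obtain \<xi> where "\<xi> \<in> unit_circle" "s = \<xi>\<^sup>2" using S(3) \<open>s \<in> S\<close> by blast
    then show ?thesis
      using power_2m[of \<xi>] by (simp add: unit_circle_def one_gauss_def power_mult)
  qed
  \<comment> \<open>If N z = c^2, then \<open>z ^ m\<close> is a square root of c^2 in a ring
    without zero divisors, so it is c or -c and lies in F.\<close>
  have real_power: "gconj (z ^ m) = z ^ m" if z: "gnorm z \<in> squares" for z :: "'a gauss"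
  proof -
    obtain c where c: "gnorm z = c\<^sup>2" using z by (auto simp: squares_iff)
    have "(z ^ m - Gauss c 0) * (z ^ m + Gauss c 0) = z ^ (2 * m) - Gauss (c\<^sup>2) 0"
    proof -
      have "Gauss c 0 * Gauss c 0 = Gauss (c\<^sup>2) 0"
        by (simp add: times_gauss_def power2_eq_square)
      moreover have "z ^ (2 * m) = z ^ m * z ^ m" by (simp add: mult_2 power_add)
      ultimately show ?thesis by (simp add: algebra_simps)
    qed
    also have "\<dots> = 0" by (simp add: power_2m c)
    finally have "z ^ m - Gauss c 0 = 0 \<or> z ^ m + Gauss c 0 = 0" by (rule mult_eq_0_inert)
    then have "z ^ m = Gauss c 0 \<or> z ^ m = - Gauss c 0" by (simp add: eq_neg_iff_add_eq_0)
    then show ?thesis by (auto simp: gconj_def uminus_gauss_def)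
  qed
  define p where "p = [:- 1, gconj w:] ^ m - [:w, - 1:] ^ m"
  have coeff_p: "coeff p j = 0" if "0 < j" "j < m" for j
  proof (rule inner_coeff_eq_0_of_roots_of_unity[of S m])
    show "poly p s = 0" if s: "s \<in> S" for s
    proof -
      obtain \<xi> where \<xi>: "\<xi> \<in> unit_circle" "s = \<xi>\<^sup>2" using S(3) s by blast
      have "s * gconj s = 1"
        using mult_gconj_unit_circle[OF unit_circle_power[OF \<xi>(1), of 2]] by (simp add: \<xi>(2))
      \<comment> \<open>This turns the power of the left side into a conjugate of
        \<open>(w - s) ^ m\<close>, the factor \<open>s ^ m\<close> being 1.\<close>
      then have "s * gconj w - 1 = s * gconj (w - s)"
        by (simp add: gconj_diff algebra_simps)
      then have "(s * gconj w - 1) ^ m = gconj ((w - s) ^ m)"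
        using Sm[OF s] by (simp add: power_mult_distrib gconj_power)
      also have "\<dots> = (w - s) ^ m" using real_power sq[OF \<xi>(1)] \<xi>(2) by simp
      finally show ?thesis by (simp add: p_def poly_power)
    qed
    show "degree p \<le> m"
      unfolding p_def by (intro degree_diff_le degree_linear_power_le)
    show "z = 0" if "x \<noteq> y" "(x - y) * z = 0" for x y z :: "'a gauss"
      using mult_eq_0_inert[OF that(2)] that(1) by simp
  qed (use that S Sm in auto)
  have m: "2 < m" "even m" using k by (simp_all add: m_def)
  have two_m: "2 * of_nat m = (1 :: 'a gauss)"
  proof -
    have "of_nat (CARD('a)) = (0 :: 'a)"
      using of_nat_CARD_choose_eq_0[of 1, where 'a='a] card by simp
    then have "of_nat (CARD('a) + 1) = (1 :: 'a gauss)"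
      unfolding of_nat_gauss by (simp add: one_gauss_def)
    then show ?thesis unfolding q by simp
  qed
  have "?b 1 * (w ^ (m - 1) - gconj w) = 0"
    using coeff_p[of 1] m by (simp add: p_def coeff_linear_poly_power algebra_simps)
  then have "2 * (?b 1 * (w ^ (m - 1) - gconj w)) = 0" by simp
  then have "2 * of_nat m * (w ^ (m - 1) - gconj w) = 0" by (simp add: mult.assoc)
  then have 1: "w ^ (m - 1) = gconj w" unfolding two_m by simp
  \<comment> \<open>Since \<open>2 * m\<close> is 1 in the ring, 8 times the coefficient is 2m(2m -
    2) = -1; in particular it can be cancelled.\<close>
  have b2: "8 * ?b 2 = - 1"
  proof -
    have "2 * (m choose 2) = m * (m - 1)"
      using m by (simp add: choose_two)
    then have "of_nat (2 * (m choose 2)) = (of_nat (m * (m - 1)) :: 'a gauss)" by simp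
    then have *: "2 * ?b 2 = of_nat m * (of_nat m - 1)"
      using m by (simp add: of_nat_diff)
    have "8 * ?b 2 = 4 * (2 * ?b 2)" by simp
    also have "\<dots> = 2 * of_nat m * (2 * of_nat m - 2)"
      unfolding * by (simp add: algebra_simps)
    finally show ?thesis unfolding two_m by simp
  qed
  have "?b 2 * ((gconj w)\<^sup>2 - w ^ (m - 2)) = 0"
    using coeff_p[of 2] m by (simp add: p_def coeff_linear_poly_power algebra_simps)
  then have "8 * (?b 2 * ((gconj w)\<^sup>2 - w ^ (m - 2))) = 0" by simp
  then have "8 * ?b 2 * ((gconj w)\<^sup>2 - w ^ (m - 2)) = 0" by (simp add: mult.assoc)
  then have 2: "(gconj w)\<^sup>2 = w ^ (m - 2)" unfolding b2 by simp
  have "(w * gconj w - 1) * gconj w = w * (gconj w)\<^sup>2 - gconj w"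
    by (simp add: algebra_simps power2_eq_square)
  also have "w * (gconj w)\<^sup>2 = w ^ (m - 1)"
    unfolding 2 using m by (simp flip: power_Suc add: Suc_diff_Suc numeral_2_eq_2)
  finally have "(w * gconj w - 1) * gconj w = 0" unfolding 1 by simp
  moreover have "gconj w \<noteq> 0"
    using w by (cases w) (auto simp: gconj_def zero_gauss_def)
  ultimately have "w * gconj w = 1" using mult_eq_0_inert by fastforce
  then show ?thesis by (simp add: mult_gconj one_gauss_def)
qed

end

section \<open>The field of order 3 and the combination of the cases\<close>

text \<open>The squares are 0 and 1, so a point with two nonzero coordinates has the nonsquare norm
  2. The distance to 0 alone leaves only the origin and points of norm 1.\<close>

lemma card_3_in_circle_point_set:
  fixes w :: "'a::{field,finite} gauss"
  assumes card: "CARD('a) = 3" and dist: "\<And>z. z \<in> circle_point_set \<Longrightarrow> integral_distance w z"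
  shows "w \<in> circle_point_set"
proof -
  have two: "(2 :: 'a) \<noteq> 0" using odd_card_two_neq_0[of 1] card by simp
  have 3: "(3 :: 'a) = 0"
    using of_nat_CARD_choose_eq_0[of 1, where 'a='a] card by simp
  have "(- 1 :: 'a) \<noteq> 1" using two by (metis add.right_inverse one_add_one)
  then have "card {0, 1, - 1 :: 'a} = card (UNIV :: 'a set)" using card by simp
  then have "{0, 1, - 1} = (UNIV :: 'a set)" by (intro card_subset_eq) auto
  then have U: "x = 0 \<or> x = 1 \<or> x = - 1" for x :: 'a by blast
  have sq01: "x \<noteq> 0 \<Longrightarrow> x\<^sup>2 = 1" for x :: 'a using U[of x] by auto
  have two_nsq: "(2 :: 'a) \<notin> squares"
  proof
    assume "(2 :: 'a) \<in> squares"
    then obtain x :: 'a where "2 = x\<^sup>2" by (auto simp: squares_iff)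
    with two sq01[of x] have "(2 :: 'a) = 1" by (cases "x = 0") auto
    then have "(1 :: 'a) + 1 = 1 + 0" by simp
    then show False unfolding add_left_cancel by simp
  qed
  have "gnorm w \<in> squares"
    using dist[of 0] by (simp add: circle_point_set_def integral_distance_def)
  moreover have "gnorm w = 2" if "gre w \<noteq> 0" "gim w \<noteq> 0"
    using that by (simp add: gnorm_def sq01)
  ultimately have "gre w = 0 \<or> gim w = 0"
    using two_nsq by metis
  then have "w = 0 \<or> gnorm w = 1"
    using sq01[of "gre w"] sq01[of "gim w"]
    by (cases "gre w = 0"; cases "gim w = 0"; cases w) (simp_all add: gnorm_def zero_gauss_def)
  then show ?thesis
    using in_circle_point_set_of_gnorm_1[OF two _ dist] by (auto simp: circle_point_set_def)
qed

lemma in_circle_point_set_of_integral_distances: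
  fixes w :: "'a::{field,finite} gauss"
  assumes odd: "odd CARD('a)" and q: "CARD('a) \<notin> {5, 9}"
    and dist: "\<And>z. z \<in> circle_point_set \<Longrightarrow> integral_distance w z"
  shows "w \<in> circle_point_set"
proof (rule ccontr)
  assume w: "w \<notin> circle_point_set"
  obtain n where card: "CARD('a) = 2 * n + 1" using odd by (elim oddE)
  have n0: "0 < n" using odd_card_half_pos[OF card] .
  have two: "(2 :: 'a) \<noteq> 0" using odd_card_two_neq_0[OF card] .
  have "gnorm w = 1"
  proof (cases "(- 1 :: 'a) \<in> squares")
    case True
    then have "(- 1 :: 'a) ^ n = 1" using square_power_half[OF card, of "- 1"] by simp
    moreover have "(- 1 :: 'a) \<noteq> 1" using two by (metis add.right_inverse one_add_one)
    ultimately have "even n" by (auto simp: minus_one_power_iff split: if_splits)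
    \<comment> \<open>The even values 2 and 4 of \<open>n\<close> are exactly the excluded orders 5
      and 9.\<close>
    moreover from this have "6 \<le> n" using q n0 card by (auto elim!: evenE)
    moreover obtain i0 :: 'a where "i0\<^sup>2 = - 1" using True by (metis squares_iff)
    ultimately show ?thesis using split_gnorm_eq_1[OF card] w dist by blast
  next
    case False
    then have "(- 1 :: 'a) ^ n = - 1" by (rule nonsquare_power_half[OF card])
    moreover have "(- 1 :: 'a) \<noteq> 1" using two by (metis add.right_inverse one_add_one)
    ultimately have "odd n" by (auto simp: minus_one_power_iff split: if_splits)
    then obtain k where "n = 2 * k + 1" by (elim oddE)
    then have card': "CARD('a) = 4 * k + 3" using card by simp
    show ?thesis
    proof (cases "k = 0")
      case True
      then show ?thesis using card_3_in_circle_point_set[OF _ dist] card' w by simp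
    next
      case k: False
      show ?thesis
      proof (rule inert_gnorm_eq_1[OF card' False])
        show "w \<noteq> 0" using w by (auto simp: circle_point_set_def)
        show "gnorm (w - \<xi>\<^sup>2) \<in> squares" if "\<xi> \<in> unit_circle" for \<xi>
          using dist[of "\<xi>\<^sup>2"] that by (auto simp: circle_point_set_def integral_distance_def)
      qed (use k in simp)
    qed
  qed
  then show False using in_circle_point_set_of_gnorm_1[OF two _ dist] w by blast
qed

theorem theorem9:
  fixes q :: nat
  assumes "q = CARD('a :: {field,finite})" and "odd q"
  shows "integral_point_set (circle_point_set :: 'a gauss set) \<and>
    (q \<notin> {5, 9} \<longrightarrow> maximal_integral_point_set (circle_point_set :: 'a gauss set))"
proof (intro conjI impI)
  show "integral_point_set (circle_point_set :: 'a gauss set)"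
    by (rule integral_circle_point_set)
  assume q: "q \<notin> {5, 9}"
  have "Q \<subseteq> circle_point_set"
    if "integral_point_set Q" "circle_point_set \<subseteq> Q" for Q :: "'a gauss set"
    using that q assms
    by (auto simp: integral_point_set_def intro!: in_circle_point_set_of_integral_distances)
  then show "maximal_integral_point_set (circle_point_set :: 'a gauss set)"
    using integral_circle_point_set by (auto simp: maximal_integral_point_set_def)
qed

end
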